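(* Let $A=(a_{ij})$ be a real $n\times n$ matrix with nonnegative entries, let $\mathbf 1=(1,\ldots,1)^{\mathrm T}\in\mathbb R^n$, and let $L=\operatorname{diag}(A\mathbf 1)-A$. Consider the system $\dot x(t)=-L\,x(t)$, $x(t)\in\mathbb R^n$. Let $\mathcal T(L)$ be the set of initial vectors $x(0)\in\mathbb R^n$ for which $\lim_{t\to\infty}x(t)$ is a vector all of whose components are equal. Then $\mathcal T(L)=\mathcal R(L)\oplus\operatorname{span}(\mathbf 1)$, where $\mathcal R(L)$ is the range (column space) of $L$.
   Context: $\mathcal T(L)$ is called the consensus domain of the algorithm $\dot x=-Lx$. The matrix $L$ is the Laplacian matrix of the algorithm; it has zero row sums. *)

theory Defs
  imports "HOL-Analysis.Analysis"
begin

text \<open>The all-ones vector.\<close>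
definition ones :: "real ^ 'n" where
  "ones = (\<chi> i. 1)"

text \<open>Laplacian L = diag(A 1) - A.\<close>
definition laplacian :: "real ^ 'n ^ 'n \<Rightarrow> real ^ 'n ^ 'n" where
  "laplacian A = (\<chi> i j. (if i = j then (\<Sum>k\<in>UNIV. A $ i $ k) else 0) - A $ i $ j)"

text \<open>A solution of x'(t) = - L x(t) on [0,\<infinity>) with initial value x0.\<close>
definition is_solution :: "real ^ 'n ^ 'n \<Rightarrow> real ^ 'n \<Rightarrow> (real \<Rightarrow> real ^ 'n) \<Rightarrow> bool" where
  "is_solution L x0 x \<longleftrightarrow> x 0 = x0 \<and>
     (\<forall>t\<ge>0. (x has_vector_derivative (- (L *v x t))) (at t within {0..}))"

text \<open>Consensus domain T(L): initial vectors whose trajectory converges to a vector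
  with all components equal.\<close>
definition consensus_domain :: "real ^ 'n ^ 'n \<Rightarrow> (real ^ 'n) set" where
  "consensus_domain L = {x0. \<exists>x. is_solution L x0 x \<and>
      (\<exists>c::real. (x \<longlongrightarrow> c *\<^sub>R ones) at_top)}"

end

theory Submission
  imports Defs
begin

(*
  The consensus domain contains R(L) + span 1 by uniformization: pick d larger than every row sum
  of A, so that Q = I - L/d is a stochastic matrix and x(t) = e^(-dt) \<Sum>n (dt)^n/n! Q^n x(0) solves
  the system. For x(0) = L y + c 1 = d (y - Q y) + c 1, the components of x(t) - c 1 are Poisson
  averages of the differences a_n - a_(n+1) of the bounded sequence a_n = (Q^n y)_i; summation by
  parts turns them into averages of a_n against the centred weights 1 - n/s, which are O(1/\<surd>s).

  Conversely, any w orthogonal to R(L) is a conserved quantity w \<bullet> x(t) of every solution, so a limit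
  c 1 forces x(0) - c 1 into the double orthogonal complement of R(L), which is R(L) itself.
  The sum is direct by the maximum principle: L y = c 1 evaluated at a minimum and at a maximum
  of y gives c \<le> 0 and c \<ge> 0.
*)

lemma laplacian_mult_vec_nth:
  "(laplacian A *v y) $ i = (\<Sum>j\<in>UNIV. A $ i $ j * (y $ i - y $ j))"
proof -
  have "(laplacian A *v y) $ i
      = (\<Sum>j\<in>UNIV. (if i = j then (\<Sum>k\<in>UNIV. A $ i $ k) * y $ j else 0)) - (\<Sum>j\<in>UNIV. A $ i $ j * y $ j)"
    unfolding matrix_vector_mult_def laplacian_def sum_subtractf[symmetric]
    by (auto intro: sum.cong simp: algebra_simps)
  also have "\<dots> = (\<Sum>j\<in>UNIV. A $ i $ j * (y $ i - y $ j))"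
    by (simp add: right_diff_distrib sum_subtractf sum_distrib_right)
  finally show ?thesis .
qed

lemma laplacian_mult_ones: "laplacian A *v ones = 0"
  by (simp add: vec_eq_iff laplacian_mult_vec_nth ones_def)

lemma laplacian_mult_vec_eq_const:
  fixes A :: "real ^ 'n ^ 'n"
  assumes nonneg: "\<forall>i j. A $ i $ j \<ge> 0" and eq: "laplacian A *v y = c *\<^sub>R ones"
  shows "c = 0"
proof -
  have fin: "finite (range (\<lambda>j. y $ j))" "range (\<lambda>j. y $ j) \<noteq> {}" by auto
  obtain m where m: "y $ m = Min (range (\<lambda>j. y $ j))" using Min_in[OF fin] by (metis imageE)
  obtain M where M: "y $ M = Max (range (\<lambda>j. y $ j))" using Max_in[OF fin] by (metis imageE)
  have "c = (\<Sum>j\<in>UNIV. A $ m $ j * (y $ m - y $ j))"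
    using eq by (simp add: vec_eq_iff ones_def laplacian_mult_vec_nth)
  also have "\<dots> \<le> 0"
    by (intro sum_nonpos mult_nonneg_nonpos) (auto simp: nonneg m)
  finally have "c \<le> 0" .
  moreover have "c = (\<Sum>j\<in>UNIV. A $ M $ j * (y $ M - y $ j))"
    using eq by (simp add: vec_eq_iff ones_def laplacian_mult_vec_nth)
  then have "c \<ge> 0"
    by (auto intro!: sum_nonneg mult_nonneg_nonneg simp: nonneg M)
  ultimately show ?thesis by simp
qed

lemma range_laplacian_Int_span_ones:
  fixes A :: "real ^ 'n ^ 'n"
  assumes "\<forall>i j. A $ i $ j \<ge> 0"
  shows "range (\<lambda>y. laplacian A *v y) \<inter> span {ones} = {0}"
proof -
  have "0 \<in> range (\<lambda>y. laplacian A *v y)"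
    by (metis matrix_vector_mult_0_right rangeI)
  then show ?thesis
    using laplacian_mult_vec_eq_const[OF assms] by (auto simp: span_singleton)
qed

definition stochastic :: "real ^ 'n ^ 'n \<Rightarrow> bool" where
  "stochastic P \<longleftrightarrow> (\<forall>i j. P $ i $ j \<ge> 0) \<and> P *v ones = ones"

lemma stochastic_mult_vec_bounded:
  assumes P: "stochastic P" and v: "\<And>j. \<bar>v $ j\<bar> \<le> B"
  shows "\<bar>(P *v v) $ i\<bar> \<le> B"
proof -
  have row: "(\<Sum>j\<in>UNIV. P $ i $ j) = 1"
    using P by (simp add: stochastic_def vec_eq_iff matrix_vector_mult_def ones_def)
  have "\<bar>(P *v v) $ i\<bar> \<le> (\<Sum>j\<in>UNIV. P $ i $ j * \<bar>v $ j\<bar>)"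
    using P sum_abs[of "\<lambda>j. P $ i $ j * v $ j" UNIV]
    by (simp add: matrix_vector_mult_def abs_mult stochastic_def)
  also have "\<dots> \<le> (\<Sum>j\<in>UNIV. P $ i $ j * B)"
    using P by (intro sum_mono mult_left_mono v) (auto simp: stochastic_def)
  finally show ?thesis by (simp add: sum_distrib_right[symmetric] row)
qed

lemma stochastic_iterate_bounded:
  assumes "stochastic P" and "\<And>j. \<bar>v $ j\<bar> \<le> B"
  shows "\<bar>(((*v) P ^^ n) v) $ i\<bar> \<le> B"
  using assms by (induction n arbitrary: i) (simp_all add: stochastic_mult_vec_bounded)

lemma stochastic_iterate_ones: "stochastic P \<Longrightarrow> ((*v) P ^^ n) ones = ones"
  by (induction n) (simp_all add: stochastic_def)

lemma linear_iterate_mult_vec: "linear ((*v) (P :: real ^ 'n ^ 'n) ^^ n)"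
proof (induction n)
  case (Suc n)
  then show ?case
    unfolding funpow.simps by (rule linear_compose[OF _ matrix_vector_mul_linear])
qed (simp add: linear_id[unfolded id_def])

lemma Suc_mult_divide_fact_Suc: "real (Suc n) * (a / fact (Suc n)) = a / fact n"
  by (simp del: of_nat_Suc)

lemma sums_exp_real: "(\<lambda>n. x ^ n / fact n) sums exp (x :: real)"
  using exp_converges[of x] by (simp add: divide_inverse mult.commute)

definition exp_mult_vec :: "real ^ 'n ^ 'n \<Rightarrow> real \<Rightarrow> real ^ 'n \<Rightarrow> real ^ 'n" where
  "exp_mult_vec P s v = (\<chi> i. \<Sum>n. (((*v) P ^^ n) v $ i / fact n) * s ^ n)"

lemma exp_mult_vec_summable:
  assumes "stochastic P"
  shows "summable (\<lambda>n. (((*v) P ^^ n) v $ i / fact n) * s ^ n)"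
proof (rule summable_comparison_test)
  define B where "B = (\<Sum>j\<in>UNIV. \<bar>v $ j\<bar>)"
  have "\<bar>v $ j\<bar> \<le> B" for j
    unfolding B_def by (rule member_le_sum) auto
  then have "\<bar>((*v) P ^^ n) v $ i\<bar> \<le> B" for n
    by (rule stochastic_iterate_bounded[OF assms])
  then show "\<exists>N. \<forall>n\<ge>N. norm ((((*v) P ^^ n) v $ i / fact n) * s ^ n) \<le> B * (\<bar>s\<bar> ^ n / fact n)"
    by (auto simp: abs_mult power_abs divide_right_mono mult_right_mono)
  show "summable (\<lambda>n. B * (\<bar>s\<bar> ^ n / fact n))"
    by (rule summable_mult[OF sums_summable[OF sums_exp_real]])
qed

lemma exp_mult_vec_nth_sums:
  "stochastic P \<Longrightarrow> (\<lambda>n. (((*v) P ^^ n) v $ i / fact n) * s ^ n) sums (exp_mult_vec P s v $ i)"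
  using summable_sums[OF exp_mult_vec_summable] by (simp only: exp_mult_vec_def vec_lambda_beta)

lemma linear_exp_mult_vec:
  assumes P: "stochastic P"
  shows "linear (exp_mult_vec P s)"
proof (rule linearI)
  note iterate = linear_iterate_mult_vec[where P=P]
  show "exp_mult_vec P s (u + v) = exp_mult_vec P s u + exp_mult_vec P s v" for u v
  proof -
    have "(\<lambda>n. (((*v) P ^^ n) (u + v) $ i / fact n) * s ^ n) sums
        (exp_mult_vec P s u $ i + exp_mult_vec P s v $ i)" for i
      using sums_add[OF exp_mult_vec_nth_sums[OF P] exp_mult_vec_nth_sums[OF P]]
      by (simp add: linear_add[OF iterate] add_divide_distrib distrib_right)
    then show ?thesis
      by (simp add: vec_eq_iff sums_unique2[OF exp_mult_vec_nth_sums[OF P]])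
  qed
  show "exp_mult_vec P s (c *\<^sub>R v) = c *\<^sub>R exp_mult_vec P s v" for c v
  proof -
    have "(\<lambda>n. (((*v) P ^^ n) (c *\<^sub>R v) $ i / fact n) * s ^ n) sums (c * exp_mult_vec P s v $ i)" for i
      using sums_mult[OF exp_mult_vec_nth_sums[OF P], of c]
      by (simp add: linear_scale[OF iterate] mult.assoc)
    then show ?thesis
      by (simp add: vec_eq_iff sums_unique2[OF exp_mult_vec_nth_sums[OF P]])
  qed
qed

lemma exp_mult_vec_ones:
  assumes "stochastic P"
  shows "exp_mult_vec P s ones = exp s *\<^sub>R ones"
proof -
  have "((*v) P ^^ n) ones $ i = 1" for n i
    by (simp add: stochastic_iterate_ones[OF assms]) (simp add: ones_def)
  then show ?thesis
    using sums_unique[OF sums_exp_real]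
    by (simp add: exp_mult_vec_def vec_eq_iff ones_def mult.commute)
qed

lemma exp_mult_vec_zero: "exp_mult_vec P 0 v = v"
  using powser_zero[of "\<lambda>n. ((*v) P ^^ n) v $ _ / fact n"]
  by (simp add: exp_mult_vec_def vec_eq_iff)

lemma exp_mult_vec_has_real_derivative:
  assumes P: "stochastic P"
  shows "((\<lambda>s. exp_mult_vec P s v $ i) has_real_derivative (P *v exp_mult_vec P s v) $ i) (at s)"
proof -
  define c where "c j n = ((*v) P ^^ n) v $ j / fact n" for j n
  have "((\<lambda>s. exp_mult_vec P s v $ i) has_real_derivative (\<Sum>n. diffs (c i) n * s ^ n)) (at s)"
    unfolding exp_mult_vec_def vec_lambda_beta c_def[symmetric]
    by (rule termdiffs_strong_converges_everywhere) (use exp_mult_vec_summable[OF P] in \<open>simp add: c_def\<close>)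
  moreover have "diffs (c i) n * s ^ n = (\<Sum>j\<in>UNIV. P $ i $ j * (c j n * s ^ n))" for n
    unfolding diffs_def c_def Suc_mult_divide_fact_Suc
    by (simp add: matrix_vector_mult_def sum_divide_distrib sum_distrib_right mult.assoc)
  moreover have "(\<lambda>n. \<Sum>j\<in>UNIV. P $ i $ j * (c j n * s ^ n)) sums
      (\<Sum>j\<in>UNIV. P $ i $ j * exp_mult_vec P s v $ j)"
    unfolding c_def by (intro sums_sum sums_mult exp_mult_vec_nth_sums[OF P])
  ultimately show ?thesis
    by (simp add: sums_iff matrix_vector_mult_def)
qed

lemma vec_has_vector_derivativeI:
  fixes f :: "real \<Rightarrow> real ^ 'n"
  assumes "\<And>i. ((\<lambda>t. f t $ i) has_real_derivative (D $ i)) (at t within S)"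
  shows "(f has_vector_derivative D) (at t within S)"
  unfolding has_vector_derivative_def
proof (subst has_derivative_componentwise_within, intro ballI)
  fix b :: "real ^ 'n" assume "b \<in> Basis"
  then obtain i where b: "b = axis i 1" by (auto simp: Basis_vec_def)
  show "((\<lambda>x. f x \<bullet> b) has_derivative (\<lambda>x. x *\<^sub>R D \<bullet> b)) (at t within S)"
    using assms[of i, unfolded has_real_derivative_iff_has_vector_derivative has_vector_derivative_def]
    unfolding b by (simp add: cart_eq_inner_axis[symmetric])
qed

text \<open>If L = d (I - Q), then e^(-tL) = e^(-dt) e^(dtQ).\<close>

definition uniformized_flow :: "real ^ 'n ^ 'n \<Rightarrow> real \<Rightarrow> real ^ 'n \<Rightarrow> real \<Rightarrow> real ^ 'n" where
  "uniformized_flow Q d v t = exp (- (d * t)) *\<^sub>R exp_mult_vec Q (d * t) v"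

lemma uniformized_flow_is_solution:
  assumes Q: "stochastic Q" and L: "\<And>v. L *v v = d *\<^sub>R (v - Q *v v)"
  shows "is_solution L v (uniformized_flow Q d v)"
  unfolding is_solution_def
proof (intro conjI allI impI)
  show "uniformized_flow Q d v 0 = v"
    by (simp add: uniformized_flow_def exp_mult_vec_zero)
  fix t :: real
  show "(uniformized_flow Q d v has_vector_derivative - (L *v uniformized_flow Q d v t)) (at t within {0..})"
  proof (rule vec_has_vector_derivativeI)
    fix i
    have "((\<lambda>t. exp (- (d * t)) * exp_mult_vec Q (d * t) v $ i) has_real_derivative
        exp (- (d * t)) * ((Q *v exp_mult_vec Q (d * t) v) $ i * d)
          + exp (- (d * t)) * (- d) * exp_mult_vec Q (d * t) v $ i) (at t)"
      by (intro DERIV_mult' DERIV_chain2[OF exp_mult_vec_has_real_derivative[OF Q]])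
         (auto intro!: derivative_eq_intros)
    then show "((\<lambda>t. uniformized_flow Q d v t $ i) has_real_derivative
        (- (L *v uniformized_flow Q d v t)) $ i) (at t within {0..})"
      by (auto simp: uniformized_flow_def L matrix_vector_mult_scaleR algebra_simps
          intro: has_field_derivative_at_within)
  qed
qed

lemma sums_exp_moment1: "(\<lambda>n. real n * (x ^ n / fact n)) sums (x * exp (x :: real))"
proof -
  have "(\<lambda>m. real (Suc m) * (x ^ Suc m / fact (Suc m))) sums (x * exp x)"
    using sums_mult[OF sums_exp_real, of x x] by (simp add: Suc_mult_divide_fact_Suc)
  then show ?thesis by (subst (asm) sums_Suc_iff) simp
qed

lemma sums_exp_moment2: "(\<lambda>n. (real n)\<^sup>2 * (x ^ n / fact n)) sums (x * (x + 1) * exp (x :: real))"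
proof -
  have "(\<lambda>m. x * (real m * (x ^ m / fact m) + x ^ m / fact m)) sums (x * (x * exp x + exp x))"
    by (intro sums_mult sums_add sums_exp_moment1 sums_exp_real)
  moreover have "(real (Suc m))\<^sup>2 * (x ^ Suc m / fact (Suc m))
      = x * (real m * (x ^ m / fact m) + x ^ m / fact m)" for m
  proof -
    have "(real (Suc m))\<^sup>2 * (x ^ Suc m / fact (Suc m))
        = real (Suc m) * (real (Suc m) * (x ^ Suc m / fact (Suc m)))"
      by (simp only: power2_eq_square mult.assoc)
    also have "\<dots> = real (Suc m) * (x * (x ^ m / fact m))"
      by (simp only: Suc_mult_divide_fact_Suc) simp
    finally show ?thesis by (simp add: field_simps)
  qed
  ultimately have "(\<lambda>m. (real (Suc m))\<^sup>2 * (x ^ Suc m / fact (Suc m))) sums (x * (x * exp x + exp x))"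
    by presburger
  then show ?thesis by (subst (asm) sums_Suc_iff) (simp add: algebra_simps)
qed

lemma poisson_centered_second_moment:
  assumes "s > 0"
  shows "(\<lambda>n. s ^ n / fact n * (1 - real n / s)\<^sup>2) sums (exp s / s)"
proof -
  have "(\<lambda>n. s ^ n / fact n - 2 / s * (real n * (s ^ n / fact n)) + 1 / s\<^sup>2 * ((real n)\<^sup>2 * (s ^ n / fact n)))
      sums (exp s - 2 / s * (s * exp s) + 1 / s\<^sup>2 * (s * (s + 1) * exp s))"
    by (intro sums_add sums_diff sums_mult sums_exp_real sums_exp_moment1 sums_exp_moment2)
  then show ?thesis
    using assms by (simp add: power2_eq_square field_simps)
qed

lemma abs_le_half_add_square_div:
  fixes x e :: real
  assumes "e > 0"
  shows "\<bar>x\<bar> \<le> e / 2 + x\<^sup>2 / (2 * e)"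
proof -
  have "0 \<le> (\<bar>x\<bar> - e)\<^sup>2" by simp
  then show ?thesis
    using assms by (simp add: power2_eq_square field_simps)
qed

lemma poisson_weighted_bounded:
  fixes a :: "nat \<Rightarrow> real"
  assumes s: "s > 0" and a: "\<And>n. \<bar>a n\<bar> \<le> B"
  shows "\<bar>\<Sum>n. s ^ n / fact n * (1 - real n / s) * a n\<bar> \<le> B * exp s / sqrt s"
proof -
  \<comment> \<open>AM-GM with the weight e = 1/\<surd>s that balances the Poisson mass e^s against the variance e^s/s\<close>
  define e where "e = 1 / sqrt s"
  have e: "e > 0" using s by (simp add: e_def)
  define h where "h n = B * (e / 2) * (s ^ n / fact n) + B / (2 * e) * (s ^ n / fact n * (1 - real n / s)\<^sup>2)" for n
  have "h sums (B * (e / 2) * exp s + B / (2 * e) * (exp s / s))"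
    unfolding h_def by (intro sums_add sums_mult sums_exp_real poisson_centered_second_moment s)
  moreover have "B * (e / 2) * exp s + B / (2 * e) * (exp s / s) = B * exp s / sqrt s"
    using s by (simp add: e_def field_simps real_sqrt_mult[symmetric])
  ultimately have h: "h sums (B * exp s / sqrt s)" by simp
  have bound: "norm (s ^ n / fact n * (1 - real n / s) * a n) \<le> h n" for n
  proof -
    have "norm (s ^ n / fact n * (1 - real n / s) * a n) = s ^ n / fact n * \<bar>1 - real n / s\<bar> * \<bar>a n\<bar>"
      using s by (simp add: abs_mult)
    also have "\<dots> \<le> s ^ n / fact n * (e / 2 + (1 - real n / s)\<^sup>2 / (2 * e)) * B"
      using s e a[of n] abs_le_half_add_square_div[OF e, of "1 - real n / s"]
      by (intro mult_mono mult_left_mono) auto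
    finally show ?thesis by (simp add: h_def algebra_simps)
  qed
  have "norm (\<Sum>n. s ^ n / fact n * (1 - real n / s) * a n) \<le> suminf h"
    by (rule norm_suminf_le[OF bound sums_summable[OF h]])
  then show ?thesis
    using sums_unique[OF h] by simp
qed

lemma poisson_summation_by_parts:
  fixes a :: "nat \<Rightarrow> real"
  assumes s: "s > 0" and a: "\<And>n. \<bar>a n\<bar> \<le> B"
  shows "(\<lambda>n. s ^ n / fact n * (a n - a (Suc n))) sums (\<Sum>n. s ^ n / fact n * (1 - real n / s) * a n)"
proof -
  define p where "p n = s ^ n / fact n" for n
  have pa_bound: "\<bar>p n * a n\<bar> \<le> B * p n" for n
    using s mult_left_mono[OF a[of n], of "p n"] by (simp add: p_def abs_mult mult.commute)
  have pa: "summable (\<lambda>n. p n * a n)"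
    by (rule summable_comparison_test'[where N=0, OF summable_mult[OF sums_summable[OF sums_exp_real]]])
       (use pa_bound in \<open>simp add: p_def\<close>)
  have qa: "summable (\<lambda>n. real n / s * p n * a n)"
  proof (rule summable_comparison_test'[where N=0])
    show "summable (\<lambda>n. B / s * (real n * p n))"
      unfolding p_def by (rule summable_mult[OF sums_summable[OF sums_exp_moment1]])
    show "norm (real n / s * p n * a n) \<le> B / s * (real n * p n)" for n
      using s mult_left_mono[OF pa_bound[of n], of "real n / s"] by (simp add: abs_mult algebra_simps)
  qed
  have shift: "real (Suc n) / s * p (Suc n) = p n" for n
    \<comment> \<open>this shift moves \<Sum> p_n a_(n+1) onto \<Sum> (n/s) p_n a_n\<close>
  proof -
    have "real (Suc n) / s * p (Suc n) = real (Suc n) * (s ^ Suc n / fact (Suc n)) / s"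
      by (simp add: p_def)
    also have "\<dots> = p n"
      using s unfolding Suc_mult_divide_fact_Suc by (simp add: p_def)
    finally show ?thesis .
  qed
  have "(\<lambda>n. real (Suc n) / s * p (Suc n) * a (Suc n)) sums (\<Sum>n. real n / s * p n * a n)"
    by (subst sums_Suc_iff) (use summable_sums[OF qa] in simp)
  then have "(\<lambda>n. p n * a (Suc n)) sums (\<Sum>n. real n / s * p n * a n)"
    by (simp only: shift)
  from sums_diff[OF summable_sums[OF pa] this]
  have "(\<lambda>n. p n * (a n - a (Suc n))) sums (\<Sum>n. p n * a n - real n / s * p n * a n)"
    by (simp only: right_diff_distrib suminf_diff[OF pa qa])
  moreover have "p n * a n - real n / s * p n * a n = s ^ n / fact n * (1 - real n / s) * a n" for n
    using s by (simp add: p_def field_simps)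
  ultimately show ?thesis
    unfolding p_def by simp
qed

lemma uniformized_flow_range_tendsto_zero:
  assumes Q: "stochastic Q" and d: "d > 0"
  shows "(uniformized_flow Q d (y - Q *v y) \<longlongrightarrow> 0) at_top"
proof (rule vec_tendstoI)
  fix i
  define a where "a n = ((*v) Q ^^ n) y $ i" for n
  define B where "B = (\<Sum>j\<in>UNIV. \<bar>y $ j\<bar>)"
  have "\<bar>y $ j\<bar> \<le> B" for j
    unfolding B_def by (rule member_le_sum) auto
  then have a: "\<bar>a n\<bar> \<le> B" for n
    unfolding a_def by (rule stochastic_iterate_bounded[OF Q])
  have bound: "\<bar>uniformized_flow Q d (y - Q *v y) t $ i\<bar> \<le> B / sqrt (d * t)" if "t > 0" for t
  proof -
    define s where "s = d * t"
    have s: "s > 0" using d that by (simp add: s_def)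
    have "((*v) Q ^^ n) (y - Q *v y) $ i = a n - a (Suc n)" for n
      by (simp add: a_def linear_diff[OF linear_iterate_mult_vec] funpow_Suc_right del: funpow.simps)
    then have "(\<lambda>n. s ^ n / fact n * (a n - a (Suc n))) sums exp_mult_vec Q s (y - Q *v y) $ i"
      using exp_mult_vec_nth_sums[OF Q, where s=s and v="y - Q *v y" and i=i] by (simp add: mult.commute)
    then have "exp_mult_vec Q s (y - Q *v y) $ i = (\<Sum>n. s ^ n / fact n * (1 - real n / s) * a n)"
      by (rule sums_unique2[OF _ poisson_summation_by_parts[OF s a]])
    then have "\<bar>uniformized_flow Q d (y - Q *v y) t $ i\<bar>
        = exp (- s) * \<bar>\<Sum>n. s ^ n / fact n * (1 - real n / s) * a n\<bar>"
      by (simp add: uniformized_flow_def s_def abs_mult)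
    also have "\<dots> \<le> exp (- s) * (B * exp s / sqrt s)"
      by (rule mult_left_mono[OF poisson_weighted_bounded[where a=a, OF s a]]) simp
    also have "\<dots> = B / sqrt s"
      by (simp add: exp_minus field_simps)
    finally show ?thesis by (simp add: s_def)
  qed
  have ev: "\<forall>\<^sub>F t in at_top. norm (uniformized_flow Q d (y - Q *v y) t $ i) \<le> B / sqrt (d * t)"
    using bound by (auto intro!: eventually_at_top_linorderI[of 1])
  have "LIM t at_top. sqrt (d * t) :> at_top"
    using filterlim_compose[OF sqrt_at_top filterlim_tendsto_pos_mult_at_top[OF tendsto_const d filterlim_ident]] .
  then have "((\<lambda>t. B / sqrt (d * t)) \<longlongrightarrow> 0) at_top"
    by (intro tendsto_divide_0[OF tendsto_const] filterlim_at_top_imp_at_infinity)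
  from Lim_null_comparison[OF ev this]
  show "((\<lambda>t. uniformized_flow Q d (y - Q *v y) t $ i) \<longlongrightarrow> 0 $ i) at_top"
    by simp
qed

lemma uniformized_flow_tendsto:
  assumes Q: "stochastic Q" and d: "d > 0"
  shows "(uniformized_flow Q d (d *\<^sub>R (y - Q *v y) + c *\<^sub>R ones) \<longlongrightarrow> c *\<^sub>R ones) at_top"
proof -
  note lin = linear_exp_mult_vec[OF Q]
  have "uniformized_flow Q d (d *\<^sub>R (y - Q *v y) + c *\<^sub>R ones)
      = (\<lambda>t. d *\<^sub>R uniformized_flow Q d (y - Q *v y) t + c *\<^sub>R ones)"
    unfolding uniformized_flow_def linear_add[OF lin] linear_scale[OF lin] exp_mult_vec_ones[OF Q]
    by (simp add: exp_minus inverse_eq_divide scaleR_add_right)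
  moreover have "((\<lambda>t. d *\<^sub>R uniformized_flow Q d (y - Q *v y) t + c *\<^sub>R ones) \<longlongrightarrow> d *\<^sub>R 0 + c *\<^sub>R ones) at_top"
    by (intro tendsto_add tendsto_scaleR tendsto_const uniformized_flow_range_tendsto_zero[OF Q d])
  ultimately show ?thesis
    by simp
qed

lemma laplacian_uniformization:
  fixes A :: "real ^ 'n ^ 'n"
  assumes nonneg: "\<forall>i j. A $ i $ j \<ge> 0"
  obtains Q d where "stochastic Q" and "d > 0" and "\<And>v. laplacian A *v v = d *\<^sub>R (v - Q *v v)"
proof
  define d where "d = 1 + (\<Sum>i\<in>UNIV. \<Sum>k\<in>UNIV. A $ i $ k)"
  have row: "(\<Sum>k\<in>UNIV. A $ i $ k) \<le> d - 1" for i
    unfolding d_def using nonneg by (auto intro!: member_le_sum sum_nonneg)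
  have "0 \<le> (\<Sum>i\<in>UNIV. \<Sum>k\<in>UNIV. A $ i $ k)"
    using nonneg by (simp add: sum_nonneg)
  then show d: "d > 0"
    by (simp add: d_def)
  define Q where "Q = mat 1 - (1 / d) *\<^sub>R laplacian A"
  show "laplacian A *v v = d *\<^sub>R (v - Q *v v)" for v
    using d by (simp add: Q_def matrix_vector_mult_diff_rdistrib scaleR_matrix_vector_assoc)
  have "Q $ i $ j \<ge> 0" for i j
  proof (cases "i = j")
    case True
    have "(\<Sum>k\<in>UNIV. A $ i $ k) - A $ i $ i \<le> d"
      using row[of i] nonneg[rule_format, of i i] by linarith
    with True d show ?thesis
      by (simp add: Q_def laplacian_def mat_def divide_le_eq)
  next
    case False
    with d nonneg show ?thesis
      by (simp add: Q_def laplacian_def mat_def)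
  qed
  moreover have "Q *v ones = ones"
    by (simp add: Q_def matrix_vector_mult_diff_rdistrib scaleR_matrix_vector_assoc[symmetric]
        laplacian_mult_ones)
  ultimately show "stochastic Q"
    by (simp add: stochastic_def)
qed

lemma is_solution_inner_constant:
  assumes sol: "is_solution L x0 x" and w: "w \<in> (range ((*v) L))\<^sup>\<bottom>" and t: "t \<ge> 0"
  shows "inner w (x t) = inner w x0"
proof -
  have deriv: "((\<lambda>t. inner w (x t)) has_vector_derivative 0) (at t within {0..})" if "t \<in> {0..}" for t
  proof -
    have "(x has_vector_derivative - (L *v x t)) (at t within {0..})"
      using sol that by (auto simp: is_solution_def)
    then have "((\<lambda>t. inner w (x t)) has_vector_derivative inner w (- (L *v x t))) (at t within {0..})"
      by (rule bounded_linear.has_vector_derivative[OF bounded_linear_inner_right])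
    moreover have "inner w (L *v x t) = 0"
      using w by (auto simp: orthogonal_comp_def orthogonal_def inner_commute)
    ultimately show ?thesis
      by simp
  qed
  obtain c where "\<And>t. t \<in> {0..} \<Longrightarrow> inner w (x t) = c"
    by (rule has_vector_derivative_zero_constant[of "{0::real..}"]) (use deriv in auto)
  with t sol show ?thesis
    by (metis atLeast_iff is_solution_def order_refl)
qed

lemma consensus_domain_diff_const_in_range:
  fixes L :: "real ^ 'n ^ 'n"
  assumes "x0 \<in> consensus_domain L"
  obtains c where "x0 - c *\<^sub>R ones \<in> range ((*v) L)"
proof -
  obtain x c where sol: "is_solution L x0 x" and lim: "(x \<longlongrightarrow> c *\<^sub>R ones) at_top"
    using assms unfolding consensus_domain_def by auto
  have "inner w (x0 - c *\<^sub>R ones) = 0" if w: "w \<in> (range ((*v) L))\<^sup>\<bottom>" for w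
  proof -
    have "\<forall>\<^sub>F t in at_top. inner w (x t) = inner w x0"
      using is_solution_inner_constant[OF sol w] by (auto intro: eventually_at_top_linorderI[of 0])
    then have "((\<lambda>t. inner w (x t)) \<longlongrightarrow> inner w x0) at_top"
      by (rule tendsto_eventually)
    moreover have "((\<lambda>t. inner w (x t)) \<longlongrightarrow> inner w (c *\<^sub>R ones)) at_top"
      by (intro tendsto_intros lim)
    ultimately show ?thesis
      using tendsto_unique[OF trivial_limit_at_top_linorder] by (simp add: inner_diff_right)
  qed
  then have "x0 - c *\<^sub>R ones \<in> (range ((*v) L))\<^sup>\<bottom>\<^sup>\<bottom>"
    by (auto simp: orthogonal_comp_def orthogonal_def)
  moreover have "subspace (range ((*v) L))"
    using linear_subspace_image[OF matrix_vector_mul_linear[of L] subspace_UNIV] by simp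
  ultimately show ?thesis
    using orthogonal_comp_self that by blast
qed

theorem theorem3:
  fixes A :: "real ^ 'n ^ 'n"
  assumes "\<forall>i j. A $ i $ j \<ge> 0"
  shows "consensus_domain (laplacian A) =
           {u + v | u v. u \<in> range (\<lambda>y. laplacian A *v y) \<and> v \<in> span {ones}}
         \<and> range (\<lambda>y. laplacian A *v y) \<inter> span {ones} = {0}"
proof (intro conjI subset_antisym subsetI)
  fix x0 assume "x0 \<in> consensus_domain (laplacian A)"
  then obtain c where "x0 - c *\<^sub>R ones \<in> range (\<lambda>y. laplacian A *v y)"
    by (rule consensus_domain_diff_const_in_range)
  moreover have "c *\<^sub>R ones \<in> span {ones}"
    by (simp add: span_base span_mul)
  ultimately show "x0 \<in> {u + v | u v. u \<in> range (\<lambda>y. laplacian A *v y) \<and> v \<in> span {ones}}"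
    by (metis (mono_tags, lifting) diff_add_cancel mem_Collect_eq)
next
  fix x0 assume "x0 \<in> {u + v | u v. u \<in> range (\<lambda>y. laplacian A *v y) \<and> v \<in> span {ones}}"
  then obtain y c where x0: "x0 = laplacian A *v y + c *\<^sub>R ones"
    by (auto simp: span_singleton)
  obtain Q d where Q: "stochastic Q" and d: "d > 0" and L: "\<And>v. laplacian A *v v = d *\<^sub>R (v - Q *v v)"
    using laplacian_uniformization[OF assms] by blast
  have "is_solution (laplacian A) x0 (uniformized_flow Q d x0)"
    by (rule uniformized_flow_is_solution[OF Q L])
  moreover have "(uniformized_flow Q d x0 \<longlongrightarrow> c *\<^sub>R ones) at_top"
    unfolding x0 L by (rule uniformized_flow_tendsto[OF Q d])
  ultimately show "x0 \<in> consensus_domain (laplacian A)"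
    unfolding consensus_domain_def by blast
qed (use range_laplacian_Int_span_ones[OF assms] in auto)

end
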